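(* The property SWMd does not imply the property SWA: there exist a sequence $(\Omega_N)_N$ of finite sets with $\#\Omega_N=N$ and a distance function $d$ on $\mathbf{\Omega}=\bigcup_N\Omega_N$ such that $(\mathbf{\Omega},d)$ is an SWMd but not an SWA.
   Context: For $N\ge 2$ put $\mu_N=\frac{1}{N(N-1)}\sum_{A,B\in\Omega_N, A\neq B} d(A,B)$ (the average distance; the sum is over ordered pairs) and $Md_N=$ the median of the multiset $\{\{d(A,B): A,B\in\Omega_N, A\ne B\}\}$. $(\mathbf{\Omega},d)$ is called an SWA (small world based on the average distance) if there is a finite constant $C\ge 0$ with $\lim_{N\to\infty}\frac{\mu_N}{\ln N}=C$; it is called an SWMd (small world based on the median distance) if there is a finite constant $C\ge 0$ with $\lim_{N\to\infty}\frac{Md_N}{\ln N}=C$. A distance function is a metric in the usual sense. *)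

theory Defs
  imports "HOL-Analysis.Analysis" "HOL-Library.Multiset"
begin

definition distinct_pairs :: "'a set \<Rightarrow> ('a \<times> 'a) set" where
  "distinct_pairs S = {(A, B). A \<in> S \<and> B \<in> S \<and> A \<noteq> B}"

(* For an odd number n of elements the two indices coincide; for an even one they are the
   two middle positions, so the median is the mean of the two middle values.
   The value at the empty multiset is irrelevant. *)
definition median_mset :: "real multiset \<Rightarrow> real" where
  "median_mset M =
     (let xs = sorted_list_of_multiset M; n = length xs
      in (xs ! ((n - 1) div 2) + xs ! (n div 2)) / 2)"

definition avg_dist :: "(nat \<Rightarrow> 'a set) \<Rightarrow> ('a \<Rightarrow> 'a \<Rightarrow> real) \<Rightarrow> nat \<Rightarrow> real" where
  "avg_dist \<Omega> d N =
     1 / (real N * (real N - 1)) * (\<Sum>(A, B)\<in>distinct_pairs (\<Omega> N). d A B)"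

(* The multiset ranges over ordered pairs; over unordered pairs every multiplicity would
   be halved, which leaves the median unchanged. *)
definition median_dist :: "(nat \<Rightarrow> 'a set) \<Rightarrow> ('a \<Rightarrow> 'a \<Rightarrow> real) \<Rightarrow> nat \<Rightarrow> real" where
  "median_dist \<Omega> d N =
     median_mset {# d A B. (A, B) \<in># mset_set (distinct_pairs (\<Omega> N)) #}"

definition SWA :: "(nat \<Rightarrow> 'a set) \<Rightarrow> ('a \<Rightarrow> 'a \<Rightarrow> real) \<Rightarrow> bool" where
  "SWA \<Omega> d \<longleftrightarrow> (\<exists>C\<ge>0. (\<lambda>N. avg_dist \<Omega> d N / ln (real N)) \<longlonglongrightarrow> C)"

definition SWMd :: "(nat \<Rightarrow> 'a set) \<Rightarrow> ('a \<Rightarrow> 'a \<Rightarrow> real) \<Rightarrow> bool" where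
  "SWMd \<Omega> d \<longleftrightarrow> (\<exists>C\<ge>0. (\<lambda>N. median_dist \<Omega> d N / ln (real N)) \<longlonglongrightarrow> C)"

end

(* The set \<Omega> N consists of N - 1 points at mutual distance 1 and one outlier at distance
   4 * N^2 from all of them.  Only the 2 * (N - 1) pairs that contain the outlier are not at
   distance 1, so the median is 1 as soon as N > 4, whereas these pairs alone push the average
   above N.  The common points are the odd numbers and the outlier of \<Omega> N is 2 * N; the
   distance is the maximum of the weights of two distinct points. *)
theory Submission
  imports Defs "HOL-Real_Asymp.Real_Asymp"
begin

text \<open>In sorted order the copies of the minimum \<open>c\<close> come first. Filling more than
  half of the positions, they cover both middle indices.\<close>

lemma median_mset_eq_least_majority:
  assumes least: "\<And>x. x \<in># M \<Longrightarrow> c \<le> x" and maj: "size M < 2 * count M c"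
  shows "median_mset M = c"
proof -
  define xs where "xs = sorted_list_of_multiset M"
  have M: "mset xs = M" and srt: "sorted xs"
    by (simp_all add: xs_def)
  have len: "length xs = size M"
    by (metis M size_mset)
  have cnt: "count M c = card {i. i < length xs \<and> xs ! i = c}"
    by (simp flip: M add: count_mset count_list_eq_length_filter length_filter_conv_card
        eq_commute[of c])
  have nth: "xs ! i = c" if "i < count M c" for i
  proof (rule ccontr)
    assume ne: "xs ! i \<noteq> c"
    have i: "i < length xs"
      using that count_le_size[of M c] len by linarith
    have "c \<le> xs ! i"
      using i M least by (metis nth_mem_mset)
    with ne have gt: "c < xs ! i" by simp
    \<comment> \<open>By sortedness nothing from position \<open>i\<close> on can equal
      \<open>c\<close>, so all copies of \<open>c\<close> would have to fit into the
      \<open>i\<close> positions before it.\<close>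
    have "{i. i < length xs \<and> xs ! i = c} \<subseteq> {..<i}"
    proof
      fix j assume j: "j \<in> {i. i < length xs \<and> xs ! i = c}"
      show "j \<in> {..<i}"
        using j gt sorted_nth_mono[OF srt, of i j] by (force simp: not_less)
    qed
    then have "count M c \<le> i"
      unfolding cnt by (metis card_lessThan card_mono finite_lessThan)
    with that show False by simp
  qed
  have "(size M - 1) div 2 < count M c" "size M div 2 < count M c"
    using maj by linarith+
  then show ?thesis
    by (simp add: median_mset_def Let_def nth len flip: xs_def)
qed

lemma distinct_pairs_eq: "distinct_pairs S = S \<times> S - (\<lambda>x. (x, x)) ` S"
  by (auto simp: distinct_pairs_def)

lemma finite_distinct_pairs: "finite S \<Longrightarrow> finite (distinct_pairs S)"
  by (simp add: distinct_pairs_eq)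

lemma card_distinct_pairs:
  assumes "finite S"
  shows "card (distinct_pairs S) = card S * card S - card S"
proof -
  have "card ((\<lambda>x. (x, x)) ` S) = card S"
    by (intro card_image inj_onI) simp
  then show ?thesis
    unfolding distinct_pairs_eq using assms
    by (subst card_Diff_subset) (auto simp: card_cartesian_product)
qed

text \<open>Index 0 yields the outlier. Taking an image of \<open>{..<N}\<close> makes the set empty
  for \<open>N = 0\<close>, so that its cardinality is \<open>N\<close> without exception.\<close>

definition outlier_space :: "nat \<Rightarrow> nat set" where
  "outlier_space N = (\<lambda>k. if k = 0 then 2 * N else 2 * k - 1) ` {..<N}"

text \<open>The weight depends on the point alone, not on \<open>N\<close>, so one metric serves the
  whole union; at the outlier \<open>2 * N\<close> it is \<open>4 * N^2\<close>.\<close>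

definition weight :: "nat \<Rightarrow> real" where
  "weight n = (if odd n then 1 else (real n)\<^sup>2)"

definition weight_dist :: "nat \<Rightarrow> nat \<Rightarrow> real" where
  "weight_dist a b = (if a = b then 0 else max (weight a) (weight b))"

definition common_points :: "nat \<Rightarrow> nat set" where
  "common_points N = (\<lambda>k. 2 * k - 1) ` {1..<N}"

lemma outlier_space_eq:
  assumes "N > 0"
  shows "outlier_space N = insert (2 * N) (common_points N)"
proof -
  have "{..<N} = insert 0 {1..<N}" using assms by auto
  then show ?thesis by (auto simp: outlier_space_def common_points_def)
qed

lemma odd_common_points: "a \<in> common_points N \<Longrightarrow> odd a"
  by (auto simp: common_points_def)

lemma finite_common_points: "finite (common_points N)"
  by (simp add: common_points_def)

lemma card_common_points: "card (common_points N) = N - 1"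
  unfolding common_points_def by (subst card_image) (auto intro!: inj_onI)

lemma finite_outlier_space: "finite (outlier_space N)"
  by (simp add: outlier_space_def)

lemma card_outlier_space: "card (outlier_space N) = N"
proof (cases "N = 0")
  case False
  then have "2 * N \<notin> common_points N" using odd_common_points by fastforce
  then show ?thesis
    using False by (simp add: outlier_space_eq finite_common_points card_common_points)
qed (simp add: outlier_space_def)

text \<open>This excludes 0, the only number of weight 0; all points thus have weight at least
  1.\<close>

lemma outlier_space_pos: "a \<in> outlier_space N \<Longrightarrow> 0 < a"
  by (auto simp: outlier_space_def)

lemma weight_nonneg: "0 \<le> weight n"
  by (simp add: weight_def)

lemma weight_ge_1: "0 < n \<Longrightarrow> 1 \<le> weight n"
  by (simp add: weight_def)

lemma weight_dist_nonneg: "0 \<le> weight_dist a b"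
  using weight_nonneg by (simp add: weight_dist_def le_max_iff_disj)

text \<open>For distinct \<open>x\<close>, \<open>z\<close>, the distances to any \<open>y\<close>
  other than these dominate the weights of \<open>x\<close> and \<open>z\<close> respectively, so
  their sum dominates the maximum. Weights of at least 1 separate the points.\<close>

lemma Metric_space_weight_dist: "Metric_space (\<Union>N. outlier_space N) weight_dist"
proof
  fix x y assume "x \<in> (\<Union>N. outlier_space N)" "y \<in> (\<Union>N. outlier_space N)"
  then have "1 \<le> weight x" "1 \<le> weight y"
    using outlier_space_pos weight_ge_1 by blast+
  then show "weight_dist x y = 0 \<longleftrightarrow> x = y"
    by (auto simp: weight_dist_def)
next
  fix x y z
  show "weight_dist x z \<le> weight_dist x y + weight_dist y z"
    using weight_nonneg[of x] weight_nonneg[of y] weight_nonneg[of z]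
    by (auto simp: weight_dist_def)
qed (use weight_dist_nonneg in \<open>auto simp: weight_dist_def max.commute\<close>)

lemma median_dist_outlier_space:
  assumes N: "N > 4"
  shows "median_dist outlier_space weight_dist N = 1"
proof -
  define D where "D = distinct_pairs (outlier_space N)"
  define M where "M = {# weight_dist A B. (A, B) \<in># mset_set D #}"
  have fin: "finite D"
    by (simp add: D_def finite_distinct_pairs finite_outlier_space)
  have "card (distinct_pairs (common_points N)) \<le> card {p \<in> D. case_prod weight_dist p = 1}"
  proof (rule card_mono)
    show "distinct_pairs (common_points N) \<subseteq> {p \<in> D. case_prod weight_dist p = 1}"
      using N odd_common_points
      by (auto simp: D_def distinct_pairs_def outlier_space_eq weight_dist_def weight_def)
  qed (use fin in simp)
  also have "\<dots> = count M 1"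
    unfolding M_def count_image_mset using fin
    by (auto simp: vimage_def Collect_conj_eq Int_commute intro!: arg_cong[where f = card])
  finally have count: "(N - 1) * (N - 1) - (N - 1) \<le> count M 1"
    by (simp add: card_distinct_pairs finite_common_points card_common_points)
  have size: "size M = N * N - N"
    by (simp add: M_def D_def card_distinct_pairs finite_outlier_space card_outlier_space)
  \<comment> \<open>The majority condition amounts to
    \<open>2 * (N - 1) * (N - 2) > N * (N - 1)\<close>, that is \<open>N > 4\<close>; at
    \<open>N = 4\<close> there is a tie. The substitution removes truncated subtraction.\<close>
  obtain m where "N = m + 5"
    using le_Suc_ex[of 5 N] N by (auto simp: add.commute)
  then have "size M < 2 * count M 1"
    using count size by (simp add: algebra_simps)
  moreover have "1 \<le> x" if "x \<in># M" for x
    using that fin outlier_space_pos weight_ge_1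
    by (auto simp: M_def D_def distinct_pairs_def weight_dist_def le_max_iff_disj)
  ultimately show ?thesis
    unfolding median_dist_def M_def[unfolded D_def, symmetric]
    by (intro median_mset_eq_least_majority)
qed

lemma avg_dist_outlier_space_ge:
  assumes N: "N > 1"
  shows "real N \<le> avg_dist outlier_space weight_dist N"
proof -
  have even_outlier: "2 * N \<notin> common_points N"
    using odd_common_points[of "2 * N" N] by auto
  \<comment> \<open>Only the ordered pairs with the outlier first are kept. Even without the factor
    4, dividing by \<open>N * (N - 1)\<close> leaves \<open>N\<close>.\<close>
  have "(real N - 1) * (real N)\<^sup>2 \<le> (real N - 1) * (4 * (real N)\<^sup>2)"
    using N by (intro mult_left_mono) auto
  also have "\<dots> = (\<Sum>(A, B)\<in>{2 * N} \<times> common_points N. 4 * (real N)\<^sup>2)"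
    using N by (simp add: card_cartesian_product card_common_points)
  also have "\<dots> \<le> (\<Sum>(A, B)\<in>{2 * N} \<times> common_points N. weight_dist A B)"
    using even_outlier
    by (intro sum_mono) (auto simp: weight_dist_def weight_def power_mult_distrib)
  also have "\<dots> \<le> (\<Sum>(A, B)\<in>distinct_pairs (outlier_space N). weight_dist A B)"
    using N weight_dist_nonneg even_outlier
    by (intro sum_mono2 finite_distinct_pairs finite_outlier_space)
      (auto simp: distinct_pairs_def outlier_space_eq)
  finally show ?thesis
    using N by (simp add: avg_dist_def field_simps power2_eq_square)
qed

text \<open>The median is eventually 1, so the limit constant is 0.\<close>

lemma SWMd_outlier_space: "SWMd outlier_space weight_dist"
  unfolding SWMd_def
proof (intro exI conjI)
  have "(\<lambda>N. 1 / ln (real N)) \<longlonglongrightarrow> 0"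
    by real_asymp
  then show "(\<lambda>N. median_dist outlier_space weight_dist N / ln (real N)) \<longlonglongrightarrow> 0"
  proof (rule Lim_transform_eventually)
    show "\<forall>\<^sub>F N in sequentially.
        1 / ln (real N) = median_dist outlier_space weight_dist N / ln (real N)"
      using eventually_gt_at_top[of 4] by eventually_elim (simp add: median_dist_outlier_space)
  qed
qed simp

text \<open>The quotient is eventually at least \<open>N / ln N\<close>, hence diverges to infinity
  and has no finite limit.\<close>

lemma not_SWA_outlier_space: "\<not> SWA outlier_space weight_dist"
proof -
  have "filterlim (\<lambda>N. real N / ln (real N)) at_top sequentially"
    by real_asymp
  then have "filterlim (\<lambda>N. avg_dist outlier_space weight_dist N / ln (real N)) at_top sequentially"
  proof (rule filterlim_at_top_mono)
    show "\<forall>\<^sub>F N in sequentially.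
        real N / ln (real N) \<le> avg_dist outlier_space weight_dist N / ln (real N)"
      using eventually_gt_at_top[of 1]
      by eventually_elim (intro divide_right_mono avg_dist_outlier_space_ge, auto)
  qed
  then show ?thesis
    unfolding SWA_def
    using not_tendsto_and_filterlim_at_infinity[OF sequentially_bot]
      filterlim_at_top_imp_at_infinity by blast
qed

theorem theorem4:
  "\<exists>(\<Omega> :: nat \<Rightarrow> nat set) (d :: nat \<Rightarrow> nat \<Rightarrow> real).
     (\<forall>N. finite (\<Omega> N) \<and> card (\<Omega> N) = N) \<and>
     Metric_space (\<Union>N. \<Omega> N) d \<and>
     SWMd \<Omega> d \<and> \<not> SWA \<Omega> d"
  using finite_outlier_space card_outlier_space Metric_space_weight_dist
    SWMd_outlier_space not_SWA_outlier_space by blast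

end
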